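(* Let $G$ be a finite simple graph with $m$ edges and let $M\neq\emptyset$ be a matching of $G$. Then $d(M)=m$ if and only if every edge of $M$ is a bond or a pendant edge of $G$.
   Context: A matching of $G=(V,E)$ is a set of pairwise disjoint edges; $\chi_F\in\mathbb{R}^E$ is the incidence vector of $F\subseteq E$. The matching polytope $\mathcal{M}(G)$ is the convex hull of the incidence vectors of all matchings of $G$; its vertices are exactly these vectors. The skeleton $\mathcal{G}(\mathcal{M}(G))$ is the graph whose vertices and edges are the vertices and edges (1-dimensional faces) of $\mathcal{M}(G)$, and $d(M)$ denotes the degree of $\chi_M$ in it. A pendant edge of $G$ is an edge having an endpoint of degree $1$. An edge $uv$ of $G$ is a bond if $d(u)=d(v)=2$ and $|N(u)\cap N(v)|=1$, where $d(\cdot)$ is vertex degree and $N(\cdot)$ the neighborhood in $G$. *)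

theory Defs
  imports "HOL-Analysis.Analysis"
begin

type_synonym 'a graph = "'a set \<times> 'a set set"

abbreviation verts :: "'a graph \<Rightarrow> 'a set" where
  "verts G \<equiv> fst G"

abbreviation edges :: "'a graph \<Rightarrow> 'a set set" where
  "edges G \<equiv> snd G"

definition finite_simple_graph :: "'a graph \<Rightarrow> bool" where
  "finite_simple_graph G \<longleftrightarrow>
     finite (verts G) \<and> (\<forall>e \<in> edges G. e \<subseteq> verts G \<and> card e = 2)"

definition nbhd :: "'a graph \<Rightarrow> 'a \<Rightarrow> 'a set" where
  "nbhd G v = {u \<in> verts G. {u, v} \<in> edges G}"

definition degree :: "'a graph \<Rightarrow> 'a \<Rightarrow> nat" where
  "degree G v = card (nbhd G v)"

definition matching :: "'a graph \<Rightarrow> 'a set set \<Rightarrow> bool" where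
  "matching G M \<longleftrightarrow> M \<subseteq> edges G \<and> pairwise disjnt M"

definition pendant_edge :: "'a graph \<Rightarrow> 'a set \<Rightarrow> bool" where
  "pendant_edge G e \<longleftrightarrow> e \<in> edges G \<and> (\<exists>v \<in> e. degree G v = 1)"

definition bond :: "'a graph \<Rightarrow> 'a set \<Rightarrow> bool" where
  "bond G e \<longleftrightarrow> e \<in> edges G \<and>
     (\<exists>u v. e = {u, v} \<and> degree G u = 2 \<and> degree G v = 2 \<and>
            card (nbhd G u \<inter> nbhd G v) = 1)"

text \<open>
  The space of real vectors indexed by the edges of a graph on the finite type \<open>'a\<close> is
  identified with the coordinate subspace of \<open>real ^ 'a set\<close> in which every coordinate
  that is not an edge vanishes. Convex hulls, faces and affine dimensions do not depend on the
  ambient space.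
\<close>

definition incidence_vector :: "'a::finite set set \<Rightarrow> real ^ 'a set" where
  "incidence_vector F = (\<chi> e. if e \<in> F then 1 else 0)"

definition matching_polytope :: "'a::finite graph \<Rightarrow> (real ^ 'a set) set" where
  "matching_polytope G = convex hull (incidence_vector ` {M. matching G M})"

text \<open>
  A one-dimensional face \<open>F\<close> of a polytope is a segment; as an edge of the skeleton it is
  represented by the pair of vertices of the polytope that it contains.
\<close>

definition skeleton :: "'b::euclidean_space set \<Rightarrow> 'b graph" where
  "skeleton P =
     ({x. x extreme_point_of P},
      {{x. x extreme_point_of P \<and> x \<in> F} | F. F edge_of P})"

definition matching_degree :: "'a::finite graph \<Rightarrow> 'a set set \<Rightarrow> nat" where
  "matching_degree G M = degree (skeleton (matching_polytope G)) (incidence_vector M)"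

end

theory Submission
  imports Defs
begin

text \<open>
  Two matchings \<open>M\<close> and \<open>N\<close> span an edge of the polytope iff their symmetric difference is
  connected. Connectedness enters as follows: if \<open>X\<close> contains exactly one of any two intersecting
  edges \<open>e \<in> M - N\<close>, \<open>f \<in> N - M\<close>, then \<open>X\<close> is \<open>M - N\<close> or \<open>N - M\<close>. Any other such \<open>X\<close> yields
  two further matchings whose midpoint is that of \<open>M\<close> and \<open>N\<close>. Conversely, weighting an edge of
  the symmetric difference by its number of endpoints covered by both \<open>M - N\<close> and \<open>N - M\<close>
  gives a linear functional maximised at \<open>M\<close> and \<open>N\<close> only.

  Every edge \<open>e\<close> of the graph yields a neighbour of \<open>M\<close>: delete \<open>e\<close> if it lies in \<open>M\<close>, and
  otherwise insert it and delete the edges of \<open>M\<close> that meet it. These \<open>m\<close> neighbours are distinct,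
  and there is a further one iff some \<open>e \<in> M\<close> meets two disjoint edges of the graph, which means
  that \<open>e\<close> is neither a bond nor pendant.
\<close>

section \<open>Faces and vertices of the matching polytope from edge weights\<close>

text \<open>The hyperplane at level \<open>b\<close> supports the hull, so it cuts out a face. A
  face of the hull of a finite set is the hull of some of its points, and these points lie on the
  hyperplane.\<close>

lemma convex_hull_maximizers_face_of:
  fixes S :: "'b::euclidean_space set"
  assumes "finite S" and le: "\<And>x. x \<in> S \<Longrightarrow> c \<bullet> x \<le> b"
  shows "convex hull {x \<in> S. c \<bullet> x = b} face_of convex hull S"
proof -
  let ?H = "{x. c \<bullet> x = b}"
  have "convex hull S \<subseteq> {x. c \<bullet> x \<le> b}"
    by (rule hull_minimal) (use le in \<open>auto simp: convex_halfspace_le\<close>)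
  then have face: "convex hull S \<inter> ?H face_of convex hull S"
    by (intro face_of_Int_supporting_hyperplane_le) auto
  then obtain S' where S': "S' \<subseteq> S" "convex hull S \<inter> ?H = convex hull S'"
    using face_of_convex_hull_subset[OF finite_imp_compact[OF \<open>finite S\<close>]] by metis
  have "S' \<subseteq> {x \<in> S. c \<bullet> x = b}"
    using S' hull_subset[of S' convex] by blast
  moreover have "convex hull {x \<in> S. c \<bullet> x = b} \<subseteq> convex hull S \<inter> ?H"
    by (rule hull_minimal) (auto intro: hull_inc convex_Int convex_hyperplane)
  ultimately have "convex hull {x \<in> S. c \<bullet> x = b} = convex hull S \<inter> ?H"
    using S'(2) hull_mono[of S' "{x \<in> S. c \<bullet> x = b}" convex] by blast
  with face show ?thesis by simp
qed

lemma inner_incidence_vector: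
  "c \<bullet> incidence_vector X = (\<Sum>e\<in>X. c $ e)"
  by (simp add: inner_vec_def incidence_vector_def if_distrib[of "\<lambda>x. _ * x"] sum.If_cases)

lemma incidence_vector_eq_iff: "incidence_vector A = incidence_vector B \<longleftrightarrow> A = B"
  by (auto simp: incidence_vector_def vec_eq_iff split: if_splits)

lemma matching_maximizers_face_of:
  fixes G :: "'a::finite graph" and w :: "'a set \<Rightarrow> real"
  assumes "\<And>X. matching G X \<Longrightarrow> sum w X \<le> b"
  shows "convex hull (incidence_vector ` {X. matching G X \<and> sum w X = b})
           face_of matching_polytope G"
proof -
  let ?c = "\<chi> e. w e"
  have *: "{x \<in> incidence_vector ` {X. matching G X}. ?c \<bullet> x = b}
      = incidence_vector ` {X. matching G X \<and> sum w X = b}"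
    by (auto simp: inner_incidence_vector)
  show ?thesis
    unfolding matching_polytope_def *[symmetric]
    by (rule convex_hull_maximizers_face_of) (use assms in \<open>auto simp: inner_incidence_vector\<close>)
qed

text \<open>An extreme point of a convex hull is one of its generators. Conversely, weight 1 on
  \<open>M\<close> and -1 elsewhere is maximised by \<open>M\<close> alone, so its incidence vector
  forms a face by itself.\<close>

lemma extreme_point_of_matching_polytope:
  fixes G :: "'a::finite graph"
  shows "x extreme_point_of matching_polytope G \<longleftrightarrow> (\<exists>M. matching G M \<and> x = incidence_vector M)"
proof
  assume "x extreme_point_of matching_polytope G"
  then show "\<exists>M. matching G M \<and> x = incidence_vector M"
    unfolding matching_polytope_def using extreme_point_of_convex_hull by blast
next
  assume "\<exists>M. matching G M \<and> x = incidence_vector M"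
  then obtain M where M: "matching G M" and x: "x = incidence_vector M" by blast
  define w :: "'a set \<Rightarrow> real" where "w e = (if e \<in> M then 1 else - 1)" for e
  have w: "sum w X = real (card (X \<inter> M)) - real (card (X - M))" for X
    unfolding w_def by (simp add: sum.If_cases Diff_eq)
  have le: "card (X \<inter> M) \<le> card M" for X
    by (simp add: card_mono)
  have "X = M" if "sum w X = real (card M)" for X
  proof -
    from that w[of X] le[of X] have "card (X - M) = 0" "card (X \<inter> M) = card M" by linarith+
    then show ?thesis
      using card_subset_eq[of M "X \<inter> M"] by auto
  qed
  then have "{X. matching G X \<and> sum w X = real (card M)} = {M}"
    using M w[of M] by auto
  moreover have "sum w X \<le> real (card M)" for X
    using w[of X] le[of X] by linarith
  ultimately have "{x} face_of matching_polytope G"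
    using matching_maximizers_face_of[of G w "real (card M)"] x by simp
  then show "x extreme_point_of matching_polytope G"
    by (simp add: face_of_singleton)
qed

section \<open>Combinatorial description of adjacency in the skeleton\<close>

text \<open>Join each edge of \<open>M - N\<close> to the edges of \<open>N - M\<close> that it
  meets. In every component of this bipartite graph such an \<open>X\<close> selects one of the two
  sides, so connectedness can be stated without paths.\<close>

definition alternating :: "'a set set \<Rightarrow> 'a set set \<Rightarrow> 'a set set \<Rightarrow> bool" where
  "alternating M N X \<longleftrightarrow> X \<subseteq> sym_diff M N \<and>
     (\<forall>e\<in>M - N. \<forall>f\<in>N - M. \<not> disjnt e f \<longrightarrow> (e \<in> X \<longleftrightarrow> f \<notin> X))"

text \<open>The inequality excludes the empty symmetric difference, where the condition on
  \<open>X\<close> holds trivially.\<close>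

definition adjacent_matchings :: "'a set set \<Rightarrow> 'a set set \<Rightarrow> bool" where
  "adjacent_matchings M N \<longleftrightarrow> M \<noteq> N \<and> (\<forall>X. alternating M N X \<longrightarrow> X = M - N \<or> X = N - M)"

text \<open>Disjoint edges count each vertex of \<open>I\<close> at most once. This bounds the
  weight that a matching collects from \<open>I\<close> by \<open>card I\<close>.\<close>

lemma sum_card_Int_matching:
  fixes A :: "'a::finite set set"
  assumes "pairwise disjnt A"
  shows "(\<Sum>g\<in>A. card (g \<inter> I)) = card (\<Union>A \<inter> I)"
proof -
  have "card (\<Union>g\<in>A. g \<inter> I) = (\<Sum>g\<in>A. card (g \<inter> I))"
    by (rule card_UN_disjoint) (use assms in \<open>auto simp: pairwise_def disjnt_def\<close>)
  moreover have "(\<Union>g\<in>A. g \<inter> I) = \<Union>A \<inter> I" by blast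
  ultimately show ?thesis by simp
qed

text \<open>Three estimates bound the weight of a matching: it contains at most all common edges,
  covers at most all of \<open>I\<close>, and loses one for each edge outside
  \<open>M \<union> N\<close>. If all three are tight, an alternating choice remains on the
  symmetric difference, and adjacency makes it \<open>M - N\<close> or \<open>N - M\<close>.\<close>

lemma adjacent_matchings_face_of:
  fixes G :: "'a::finite graph"
  assumes M: "matching G M" and N: "matching G N" and adj: "adjacent_matchings M N"
  shows "closed_segment (incidence_vector M) (incidence_vector N) face_of matching_polytope G"
proof -
  \<comment> \<open>Both \<open>M - N\<close> and \<open>N - M\<close> cover all of
    \<open>I\<close>, which gives \<open>M\<close> and \<open>N\<close> equal weight.\<close>
  define I where "I = \<Union>(M - N) \<inter> \<Union>(N - M)"
  let ?D = "sym_diff M N"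
  \<comment> \<open>Off the symmetric difference, 1 rewards the common edges and -1 penalises edges
    of neither matching.\<close>
  define w :: "'a set \<Rightarrow> real" where
    "w e = (if e \<in> M \<inter> N then 1 else if e \<in> ?D then real (card (e \<inter> I)) else - 1)" for e
  define b where "b = real (card (M \<inter> N)) + real (card I)"
  have w: "sum w X = real (card (X \<inter> (M \<inter> N))) + real (card (\<Union>(X \<inter> ?D) \<inter> I))
      - real (card (X - (M \<union> N)))" if "pairwise disjnt X" for X
  proof -
    have "sum w X = sum w (X \<inter> (M \<inter> N)) + sum w (X \<inter> ?D) + sum w (X - (M \<union> N))"
      by (subst sum.union_disjoint[symmetric], simp, simp, blast)+ (rule sum.cong, auto)
    moreover have "sum w (X \<inter> (M \<inter> N)) = (\<Sum>e\<in>X \<inter> (M \<inter> N). 1)"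
      by (rule sum.cong) (auto simp: w_def)
    moreover have "sum w (X - (M \<union> N)) = (\<Sum>e\<in>X - (M \<union> N). - 1)"
      by (rule sum.cong) (auto simp: w_def)
    moreover have "sum w (X \<inter> ?D) = (\<Sum>e\<in>X \<inter> ?D. real (card (e \<inter> I)))"
      by (rule sum.cong) (auto simp: w_def)
    moreover have "(\<Sum>e\<in>X \<inter> ?D. card (e \<inter> I)) = card (\<Union>(X \<inter> ?D) \<inter> I)"
      by (rule sum_card_Int_matching) (use that in \<open>auto simp: pairwise_def\<close>)
    then have "(\<Sum>e\<in>X \<inter> ?D. real (card (e \<inter> I))) = real (card (\<Union>(X \<inter> ?D) \<inter> I))"
      by (metis of_nat_sum)
    ultimately show ?thesis by simp
  qed
  have le: "card (X \<inter> (M \<inter> N)) \<le> card (M \<inter> N)" "card (\<Union>(X \<inter> ?D) \<inter> I) \<le> card I" for X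
    by (auto intro: card_mono)
  have "sum w X \<le> b" if "matching G X" for X
    using w[of X] le[of X] that unfolding matching_def b_def by linarith
  moreover have "{X. matching G X \<and> sum w X = b} = {M, N}"
  proof (intro equalityI subsetI)
    fix X assume "X \<in> {M, N}"
    moreover have "M \<inter> ?D = M - N" "N \<inter> ?D = N - M" by blast+
    moreover have "\<Union>(M - N) \<inter> I = I" "\<Union>(N - M) \<inter> I = I" by (auto simp: I_def)
    moreover have "M - (M \<union> N) = {}" "N - (M \<union> N) = {}"
      "M \<inter> (M \<inter> N) = M \<inter> N" "N \<inter> (M \<inter> N) = M \<inter> N" by blast+
    moreover have "pairwise disjnt M" "pairwise disjnt N"
      using M N by (auto simp: matching_def)
    ultimately have "sum w X = b"
      using w[of X] unfolding b_def by (elim insertE) simp_all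
    with \<open>X \<in> {M, N}\<close> M N show "X \<in> {X. matching G X \<and> sum w X = b}" by auto
  next
    fix X assume "X \<in> {X. matching G X \<and> sum w X = b}"
    then have X: "pairwise disjnt X" and b: "sum w X = b" by (auto simp: matching_def)
    \<comment> \<open>The bound \<open>b\<close> is the sum of the separate bounds, so attaining it
      makes each of them tight.\<close>
    have c: "card (X \<inter> (M \<inter> N)) = card (M \<inter> N)" "card (\<Union>(X \<inter> ?D) \<inter> I) = card I"
      "card (X - (M \<union> N)) = 0"
      using w[OF X] b le[of X] unfolding b_def by linarith+
    have sub1: "M \<inter> N \<subseteq> X" using card_subset_eq[OF _ _ c(1)] by auto
    have sub2: "I \<subseteq> \<Union>(X \<inter> ?D)" using card_subset_eq[OF _ _ c(2)] by auto
    have sub3: "X \<subseteq> M \<union> N" using c(3) by auto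
    have "alternating M N (X \<inter> ?D)"
      unfolding alternating_def
    proof (intro conjI ballI impI)
      fix e f assume e: "e \<in> M - N" and f: "f \<in> N - M" and "\<not> disjnt e f"
      then obtain v where v: "v \<in> e" "v \<in> f" by (auto simp: disjnt_def)
      with e f have "v \<in> I" by (auto simp: I_def)
      \<comment> \<open>Since \<open>X\<close> covers \<open>v\<close>, it contains an edge of the
        symmetric difference at \<open>v\<close>; only \<open>e\<close> and \<open>f\<close> are
        available, as \<open>M\<close> and \<open>N\<close> are matchings.\<close>
      with sub2 obtain g where g: "g \<in> X" "g \<in> ?D" "v \<in> g" by blast
      from g(2) have "g = e \<or> g = f"
      proof
        assume "g \<in> M - N"
        with M e v g(3) show ?thesis by (auto simp: matching_def pairwise_def disjnt_def)
      next
        assume "g \<in> N - M"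
        with N f v g(3) show ?thesis by (auto simp: matching_def pairwise_def disjnt_def)
      qed
      moreover have "\<not> (e \<in> X \<and> f \<in> X)"
        using X \<open>\<not> disjnt e f\<close> e f by (auto simp: pairwise_def)
      ultimately show "e \<in> X \<inter> ?D \<longleftrightarrow> f \<notin> X \<inter> ?D" using g e f by blast
    qed auto
    then have "X \<inter> ?D = M - N \<or> X \<inter> ?D = N - M"
      using adj by (simp add: adjacent_matchings_def)
    with sub1 sub3 show "X \<in> {M, N}" by blast
  qed
  ultimately show ?thesis
    using matching_maximizers_face_of[of G w b] by (simp add: segment_convex_hull)
qed

lemma skeleton_matching_polytope_edge_iff:
  fixes G :: "'a::finite graph"
  assumes M: "matching G M" and N: "matching G N"
  shows "{incidence_vector N, incidence_vector M} \<in> edges (skeleton (matching_polytope G))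
           \<longleftrightarrow> adjacent_matchings M N"
proof
  let ?P = "matching_polytope G" and ?m = "incidence_vector M" and ?n = "incidence_vector N"
  assume "adjacent_matchings M N"
  then have face: "closed_segment ?m ?n face_of ?P" and "?m \<noteq> ?n"
    using adjacent_matchings_face_of[OF M N]
    by (auto simp: adjacent_matchings_def incidence_vector_eq_iff)
  have "closed_segment ?m ?n edge_of ?P"
    using face \<open>?m \<noteq> ?n\<close> by (simp add: edge_of_def segment_convex_hull aff_dim_convex_hull aff_dim_2)
  moreover have "{x. x extreme_point_of ?P \<and> x \<in> closed_segment ?m ?n} = {?n, ?m}"
    using extreme_point_of_face[OF face] extreme_point_of_segment[of _ ?m ?n] by blast
  ultimately show "{?n, ?m} \<in> edges (skeleton ?P)"
    unfolding skeleton_def by auto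
next
  let ?P = "matching_polytope G" and ?m = "incidence_vector M" and ?n = "incidence_vector N"
  assume "{?n, ?m} \<in> edges (skeleton ?P)"
  then obtain F where F: "F edge_of ?P" and ext: "{x. x extreme_point_of ?P \<and> x \<in> F} = {?n, ?m}"
    unfolding skeleton_def by auto
  from F have face: "F face_of ?P" and dim: "aff_dim F = 1" by (auto simp: edge_of_def)
  have "compact ?P" "convex ?P"
    by (auto simp: matching_polytope_def finite_imp_compact_convex_hull)
  then have "compact F" "convex F"
    using face face_of_imp_compact face_of_imp_convex by blast+
  \<comment> \<open>A compact convex set is the hull of its extreme points, and those of a face are
    the extreme points of \<open>?P\<close> lying in it; so \<open>F\<close> is the segment between
    the two vertices.\<close>
  then have "F = convex hull {x. x extreme_point_of F}"
    by (rule Krein_Milman_Minkowski)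
  then have "F = convex hull {?n, ?m}"
    using extreme_point_of_face[OF face] ext by simp
  then have "?m \<noteq> ?n"
    using dim by (auto simp: aff_dim_convex_hull)
  have "X = M - N \<or> X = N - M" if X: "alternating M N X" for X
  proof -
    \<comment> \<open>Recombine \<open>M\<close> and \<open>N\<close>: \<open>X\<close> and its
      complement in the symmetric difference each receive the common edges. No intersecting pair
      stays together because \<open>X\<close> separates every such pair.\<close>
    let ?K = "X \<union> (M \<inter> N)" and ?L = "(sym_diff M N - X) \<union> (M \<inter> N)"
    let ?k = "incidence_vector ?K" and ?l = "incidence_vector ?L"
    have mn: "\<And>e f. e \<in> M \<Longrightarrow> f \<in> M \<Longrightarrow> e \<noteq> f \<Longrightarrow> disjnt e f"
        "\<And>e f. e \<in> N \<Longrightarrow> f \<in> N \<Longrightarrow> e \<noteq> f \<Longrightarrow> disjnt e f"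
      using M N by (auto simp: matching_def pairwise_def)
    have cross: "\<And>e f. e \<in> M - N \<Longrightarrow> f \<in> N - M \<Longrightarrow> (e \<in> X \<longleftrightarrow> f \<in> X) \<Longrightarrow> disjnt e f"
      and sub: "X \<subseteq> sym_diff M N"
      using X by (auto simp: alternating_def)
    have K: "matching G ?K"
      unfolding matching_def pairwise_def
    proof (intro conjI ballI impI)
      show "?K \<subseteq> edges G" using M N sub by (auto simp: matching_def)
      fix e f assume "e \<in> ?K" "f \<in> ?K" "e \<noteq> f"
      then show "disjnt e f"
        using mn[of e f] cross[of e f] cross[of f e] sub disjnt_sym[of f e] by blast
    qed
    have L: "matching G ?L"
      unfolding matching_def pairwise_def
    proof (intro conjI ballI impI)
      show "?L \<subseteq> edges G" using M N by (auto simp: matching_def)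
      fix e f assume "e \<in> ?L" "f \<in> ?L" "e \<noteq> f"
      then show "disjnt e f"
        using mn[of e f] cross[of e f] cross[of f e] disjnt_sym[of f e] by blast
    qed
    show ?thesis
    proof (cases "?k = ?l")
      case True
      then have "?K = ?L" by (simp add: incidence_vector_eq_iff)
      \<comment> \<open>Here \<open>X\<close> equals its own complement in the symmetric difference,
        which must be empty.\<close>
      then have "M = N" using sub by blast
      with \<open>?m \<noteq> ?n\<close> show ?thesis by simp
    next
      case False
      \<comment> \<open>Each edge occurs in \<open>?K\<close> and \<open>?L\<close> together as
        often as in \<open>M\<close> and \<open>N\<close> together. The common midpoint lies in
        \<open>F\<close>, and a face containing an interior point of a segment of the polytope
        contains its endpoints.\<close>
      have "?m + ?n = ?k + ?l"
        using sub by (auto simp: incidence_vector_def vec_eq_iff)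
      then have "midpoint ?m ?n = midpoint ?k ?l"
        by (simp add: midpoint_def)
      moreover have "midpoint ?k ?l \<in> open_segment ?k ?l"
        using False by simp
      moreover have "midpoint ?m ?n \<in> F"
        using \<open>F = convex hull {?n, ?m}\<close>
        by (simp add: segment_convex_hull[symmetric] closed_segment_commute[of ?n])
      moreover have k: "?k extreme_point_of ?P" and "?l extreme_point_of ?P"
        using K L extreme_point_of_matching_polytope by blast+
      then have "?k \<in> ?P" "?l \<in> ?P" by (auto simp: extreme_point_of_def)
      ultimately have "?k \<in> F"
        using face unfolding face_of_def by metis
      with k ext have "?k \<in> {?n, ?m}" by blast
      then have "?K = M \<or> ?K = N" by (simp only: insert_iff empty_iff incidence_vector_eq_iff) blast
      then show ?thesis using sub by blast
    qed
  qed
  with \<open>?m \<noteq> ?n\<close> show "adjacent_matchings M N"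
    by (auto simp: adjacent_matchings_def)
qed

lemma matching_degree_eq_card:
  fixes G :: "'a::finite graph"
  assumes M: "matching G M"
  shows "matching_degree G M = card {N. matching G N \<and> adjacent_matchings M N}"
proof -
  have "nbhd (skeleton (matching_polytope G)) (incidence_vector M)
      = incidence_vector ` {N. matching G N \<and> adjacent_matchings M N}"
    using skeleton_matching_polytope_edge_iff[OF M] extreme_point_of_matching_polytope[of _ G]
    unfolding nbhd_def by (auto simp: skeleton_def)
  moreover have "inj_on incidence_vector {N. matching G N \<and> adjacent_matchings M N}"
    by (auto simp: inj_on_def incidence_vector_eq_iff)
  ultimately show ?thesis
    by (simp add: matching_degree_def degree_def card_image)
qed

section \<open>Neighbours of a matching obtained by toggling one edge\<close>

definition toggle_edge :: "'a set set \<Rightarrow> 'a set \<Rightarrow> 'a set set" where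
  "toggle_edge M e = (if e \<in> M then M - {e} else insert e {g \<in> M. disjnt g e})"

lemma matching_toggle_edge:
  assumes "matching G M" "e \<in> edges G"
  shows "matching G (toggle_edge M e)"
  using assms unfolding matching_def toggle_edge_def pairwise_def
  by (auto simp: disjnt_sym)

text \<open>The symmetric difference is \<open>{e}\<close> or a star: \<open>e\<close> together with
  the edges of \<open>M\<close> that meet it. Whether \<open>e\<close> lies in \<open>X\<close>
  therefore decides all of \<open>X\<close>.\<close>

lemma adjacent_toggle_edge: "adjacent_matchings M (toggle_edge M e)"
  unfolding adjacent_matchings_def
proof (intro conjI allI impI)
  show "M \<noteq> toggle_edge M e" by (auto simp: toggle_edge_def)
next
  fix X assume X: "alternating M (toggle_edge M e) X"
  show "X = M - toggle_edge M e \<or> X = toggle_edge M e - M"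
  proof (cases "e \<in> M")
    case True
    with X show ?thesis by (auto simp: alternating_def toggle_edge_def)
  next
    case False
    then have D: "M - toggle_edge M e = {g \<in> M. \<not> disjnt g e}" "toggle_edge M e - M = {e}"
      by (auto simp: toggle_edge_def)
    with X have "X \<subseteq> {g \<in> M. \<not> disjnt g e} \<union> {e}"
      and "\<forall>g\<in>M. \<not> disjnt g e \<longrightarrow> (g \<in> X \<longleftrightarrow> e \<notin> X)"
      by (simp_all add: alternating_def)
    with D show ?thesis by (cases "e \<in> X") auto
  qed
qed

text \<open>Toggling either only removes \<open>e\<close> or has \<open>e\<close> as its single new
  edge, so \<open>e\<close> can be read off from the result.\<close>

lemma inj_toggle_edge: "inj (toggle_edge M)"
proof (rule injI)
  fix e f assume "toggle_edge M e = toggle_edge M f"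
  then show "e = f"
    by (cases "e \<in> M"; cases "f \<in> M") (auto simp: toggle_edge_def)
qed

text \<open>By \<open>no\<close>, an edge of \<open>M\<close> meets at most one edge of
  \<open>N\<close>. The components of the symmetric difference are thus stars centred at edges of
  \<open>N - M\<close> or single edges, and adjacency permits only one component.\<close>

lemma adjacent_matching_is_toggle:
  assumes M: "matching G M" and N: "matching G N" and adj: "adjacent_matchings M N"
    and no: "\<And>e f g. e \<in> M \<Longrightarrow> f \<in> edges G \<Longrightarrow> g \<in> edges G \<Longrightarrow>
               disjnt f g \<Longrightarrow> \<not> disjnt e f \<Longrightarrow> \<not> disjnt e g \<Longrightarrow> False"
  shows "N \<in> toggle_edge M ` edges G"
proof (cases "N \<subseteq> M")
  case True
  with adj obtain e where e: "e \<in> M" "e \<notin> N" by (auto simp: adjacent_matchings_def)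
  \<comment> \<open>With \<open>N - M\<close> empty no pairs impose a condition, so every subset of
    \<open>M - N\<close> is alternating.\<close>
  then have "alternating M N {e}" using True by (auto simp: alternating_def)
  then have "{e} = M - N" using adj True e by (auto simp: adjacent_matchings_def)
  then have "N = toggle_edge M e" using True e by (auto simp: toggle_edge_def)
  with e M show ?thesis by (auto simp: matching_def)
next
  case False
  then obtain f where f: "f \<in> N" "f \<notin> M" by blast
  \<comment> \<open>Take the \<open>N\<close> side on the star around \<open>f\<close> and the
    \<open>M\<close> side everywhere else.\<close>
  let ?X = "insert f {e \<in> M - N. disjnt e f}"
  have "alternating M N ?X"
    unfolding alternating_def
  proof (intro conjI ballI impI)
    show "?X \<subseteq> sym_diff M N" using f by blast
    fix e f' assume e: "e \<in> M - N" and f': "f' \<in> N - M" and meet: "\<not> disjnt e f'"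
    show "e \<in> ?X \<longleftrightarrow> f' \<notin> ?X"
    proof (cases "f' = f")
      case True
      with e f meet show ?thesis by auto
    next
      case False
      then have "disjnt f f'" using N f f' by (auto simp: matching_def pairwise_def)
      then have "disjnt e f"
        using no[of e f f'] e f f' meet N by (auto simp: matching_def)
      with e f' False show ?thesis by auto
    qed
  qed
  \<comment> \<open>As \<open>f\<close> is not in \<open>M\<close>, the alternative
    \<open>M - N\<close> is impossible. Hence \<open>f\<close> is the only new edge, and every edge
    of \<open>M - N\<close> meets it.\<close>
  then have X: "?X = N - M" using adj f by (auto simp: adjacent_matchings_def)
  have "N = toggle_edge M f"
  proof -
    have "g \<in> N" if "g \<in> M" "disjnt g f" for g using X that by blast
    moreover have "disjnt g f" if "g \<in> N" "g \<noteq> f" for g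
      using N f that by (auto simp: matching_def pairwise_def)
    moreover have "g \<in> M" if "g \<in> N" "g \<noteq> f" for g
      using X that by blast
    ultimately show ?thesis using f by (auto simp: toggle_edge_def)
  qed
  with f N show ?thesis by (auto simp: matching_def)
qed

text \<open>Insert both \<open>f\<close> and \<open>g\<close> and delete the edges of
  \<open>M\<close> meeting either. The two resulting stars share the leaf \<open>e\<close>, so the
  symmetric difference is connected, yet two edges are new while a toggle adds at most one.\<close>

lemma adjacent_matching_not_toggle:
  assumes M: "matching G M" and e: "e \<in> M" and f: "f \<in> edges G" and g: "g \<in> edges G"
    and fg: "disjnt f g" and ef: "\<not> disjnt e f" and eg: "\<not> disjnt e g"
  obtains N where "matching G N" "adjacent_matchings M N" "N \<notin> range (toggle_edge M)"
proof
  let ?N = "{f, g} \<union> {h \<in> M. disjnt h f \<and> disjnt h g}"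
  have ne: "f \<noteq> e" "g \<noteq> e" "f \<noteq> g"
    using fg ef eg by (auto simp: disjnt_def)
  then have fM: "f \<notin> M" and gM: "g \<notin> M"
    using M e ef eg by (auto simp: matching_def pairwise_def)
  have D: "M - ?N = {h \<in> M. \<not> disjnt h f \<or> \<not> disjnt h g}" "?N - M = {f, g}"
    using fM gM by auto
  show "matching G ?N"
    using M f g fg by (auto simp: matching_def pairwise_def disjnt_sym)
  show "adjacent_matchings M ?N"
    unfolding adjacent_matchings_def
  proof (intro conjI allI impI)
    show "M \<noteq> ?N" using fM by blast
    fix X assume "alternating M ?N X"
    then have X: "X \<subseteq> {h \<in> M. \<not> disjnt h f \<or> \<not> disjnt h g} \<union> {f, g}"
      "\<And>h. h \<in> M \<Longrightarrow> \<not> disjnt h f \<Longrightarrow> h \<in> X \<longleftrightarrow> f \<notin> X"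
      "\<And>h. h \<in> M \<Longrightarrow> \<not> disjnt h g \<Longrightarrow> h \<in> X \<longleftrightarrow> g \<notin> X"
      unfolding alternating_def D by auto
    \<comment> \<open>Both statements are equivalent to \<open>e\<close> not being in
      \<open>X\<close>.\<close>
    then have "f \<in> X \<longleftrightarrow> g \<in> X" using e ef eg by blast
    with X show "X = M - ?N \<or> X = ?N - M"
      unfolding D by (cases "f \<in> X") blast+
  qed
  show "?N \<notin> range (toggle_edge M)"
  proof
    assume "?N \<in> range (toggle_edge M)"
    then obtain h where h: "?N = toggle_edge M h" by blast
    have "toggle_edge M h - M \<subseteq> {h}" by (auto simp: toggle_edge_def)
    then show False using D(2) ne unfolding h by auto
  qed
qed

section \<open>Local characterisation of bonds and pendant edges\<close>

text \<open>Let \<open>A\<close> and \<open>B\<close> be the further neighbours of the two ends.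
  Disjoint edges meeting \<open>e\<close> amount to distinct \<open>x \<in> A\<close> and
  \<open>y \<in> B\<close>. These are missing exactly when \<open>A\<close> or \<open>B\<close> is
  empty, the pendant case, or both are the same singleton, the bond case.\<close>

lemma bond_or_pendant_edge_iff:
  assumes G: "finite_simple_graph G" and e: "e \<in> edges G"
  shows "bond G e \<or> pendant_edge G e \<longleftrightarrow>
    \<not> (\<exists>f\<in>edges G. \<exists>g\<in>edges G. disjnt f g \<and> \<not> disjnt e f \<and> \<not> disjnt e g)"
proof -
  have two: "\<exists>b. f = {a, b} \<and> a \<noteq> b \<and> b \<in> nbhd G a" if "f \<in> edges G" "a \<in> f" for f a
  proof -
    have "card f = 2" "f \<subseteq> verts G" using G that by (auto simp: finite_simple_graph_def)
    then obtain x y where xy: "f = {x, y}" "x \<noteq> y" by (auto simp: card_2_iff)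
    then obtain b where "f = {a, b}" "a \<noteq> b"
      using \<open>a \<in> f\<close> by (metis insertE insert_commute singletonD)
    with that \<open>f \<subseteq> verts G\<close> show ?thesis by (auto simp: nbhd_def insert_commute)
  qed
  have nb: "{a, b} \<in> edges G \<and> a \<noteq> b" if "b \<in> nbhd G a" for a b
    using G that by (auto simp: nbhd_def insert_commute finite_simple_graph_def)
  have fin: "finite (nbhd G a)" for a
    using G by (auto simp: nbhd_def finite_simple_graph_def)
  have "card e = 2" using G e by (simp add: finite_simple_graph_def)
  then obtain u where "u \<in> e" by (auto simp: card_2_iff)
  with two[OF e] obtain v where uv: "e = {u, v}" "u \<noteq> v" and vu: "v \<in> nbhd G u" by blast
  have "v \<in> e" using uv by simp
  from two[OF e this] uv have uv': "u \<in> nbhd G v" by (auto simp: doubleton_eq_iff)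
  define A where "A = nbhd G u - {v}"
  define B where "B = nbhd G v - {u}"
  have nu: "nbhd G u = insert v A" "v \<notin> A" and nv: "nbhd G v = insert u B" "u \<notin> B"
    using vu uv' by (auto simp: A_def B_def)
  have uA: "u \<notin> A" and vB: "v \<notin> B" using nb nu nv by blast+
  have finAB: "finite A" "finite B" using fin by (auto simp: A_def B_def)
  have deg: "degree G u = Suc (card A)" "degree G v = Suc (card B)"
    using nu nv finAB by (simp_all add: degree_def)
  have int: "nbhd G u \<inter> nbhd G v = A \<inter> B" using nu nv uA vB uv by auto
  have pendant: "pendant_edge G e \<longleftrightarrow> A = {} \<or> B = {}"
    using e uv deg finAB by (auto simp: pendant_edge_def)
  have bond: "bond G e \<longleftrightarrow> (\<exists>w. A = {w} \<and> B = {w})"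
  proof -
    have "bond G e \<longleftrightarrow> card A = 1 \<and> card B = 1 \<and> card (A \<inter> B) = 1"
      unfolding bond_def
    proof
      assume "e \<in> edges G \<and> (\<exists>a b. e = {a, b} \<and> degree G a = 2 \<and> degree G b = 2 \<and>
        card (nbhd G a \<inter> nbhd G b) = 1)"
      then obtain a b where ab: "e = {a, b}" and d: "degree G a = 2" "degree G b = 2"
        "card (nbhd G a \<inter> nbhd G b) = 1" by blast
      from ab uv(1) have "a = u \<and> b = v \<or> a = v \<and> b = u" by (simp add: doubleton_eq_iff) blast
      then have "degree G u = 2" "degree G v = 2" "card (nbhd G u \<inter> nbhd G v) = 1"
        using d by (auto simp: Int_commute)
      then show "card A = 1 \<and> card B = 1 \<and> card (A \<inter> B) = 1"
        unfolding deg int by simp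
    next
      assume "card A = 1 \<and> card B = 1 \<and> card (A \<inter> B) = 1"
      then have "degree G u = 2" "degree G v = 2" "card (nbhd G u \<inter> nbhd G v) = 1"
        unfolding deg int by simp_all
      with e uv(1) show "e \<in> edges G \<and> (\<exists>a b. e = {a, b} \<and> degree G a = 2 \<and> degree G b = 2 \<and>
        card (nbhd G a \<inter> nbhd G b) = 1)" by blast
    qed
    also have "\<dots> \<longleftrightarrow> (\<exists>w. A = {w} \<and> B = {w})"
      by (auto simp: card_1_singleton_iff)
    finally show ?thesis .
  qed
  have disjoint: "(\<exists>f\<in>edges G. \<exists>g\<in>edges G. disjnt f g \<and> \<not> disjnt e f \<and> \<not> disjnt e g)
      \<longleftrightarrow> (\<exists>x\<in>A. \<exists>y\<in>B. x \<noteq> y)"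
  proof
    assume "\<exists>x\<in>A. \<exists>y\<in>B. x \<noteq> y"
    then obtain x y where xy: "x \<in> A" "y \<in> B" "x \<noteq> y" by blast
    then have "{u, x} \<in> edges G" "{v, y} \<in> edges G" using nb nu nv by blast+
    moreover have "disjnt {u, x} {v, y}" "\<not> disjnt e {u, x}" "\<not> disjnt e {v, y}"
      using xy uv nu nv by (auto simp: disjnt_def)
    ultimately show "\<exists>f\<in>edges G. \<exists>g\<in>edges G. disjnt f g \<and> \<not> disjnt e f \<and> \<not> disjnt e g"
      by blast
  next
    have key: "\<exists>x\<in>A. \<exists>y\<in>B. x \<noteq> y"
      if fg: "f \<in> edges G" "g \<in> edges G" "disjnt f g" "u \<in> f" "v \<in> g" for f g
    proof -
      obtain x where "f = {u, x}" "x \<in> nbhd G u" using two[OF fg(1,4)] by blast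
      moreover obtain y where "g = {v, y}" "y \<in> nbhd G v" using two[OF fg(2,5)] by blast
      \<comment> \<open>Disjointness of \<open>f\<close> and \<open>g\<close> yields
        \<open>x \<noteq> v\<close>, \<open>y \<noteq> u\<close> and \<open>x \<noteq> y\<close> at
        once.\<close>
      ultimately show ?thesis using \<open>disjnt f g\<close> by (auto simp: A_def B_def disjnt_def)
    qed
    assume "\<exists>f\<in>edges G. \<exists>g\<in>edges G. disjnt f g \<and> \<not> disjnt e f \<and> \<not> disjnt e g"
    then obtain f g where fg: "f \<in> edges G" "g \<in> edges G" "disjnt f g"
      "\<not> disjnt e f" "\<not> disjnt e g" by blast
    \<comment> \<open>Disjoint edges cannot meet \<open>e\<close> in the same endpoint, so each
      takes one.\<close>
    then have "(u \<in> f \<and> v \<in> g) \<or> (u \<in> g \<and> v \<in> f)"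
      using uv by (auto simp: disjnt_def)
    then show "\<exists>x\<in>A. \<exists>y\<in>B. x \<noteq> y"
    proof (elim disjE conjE)
      assume "u \<in> f" "v \<in> g"
      with fg show ?thesis by (intro key[of f g])
    next
      assume "u \<in> g" "v \<in> f"
      with fg show ?thesis by (intro key[of g f]) (simp_all add: disjnt_sym)
    qed
  qed
  show ?thesis
    unfolding bond pendant disjoint
  proof
    assume "\<not> (\<exists>x\<in>A. \<exists>y\<in>B. x \<noteq> y)"
    then have eq: "x = y" if "x \<in> A" "y \<in> B" for x y using that by blast
    show "(\<exists>w. A = {w} \<and> B = {w}) \<or> A = {} \<or> B = {}"
    proof (cases "A = {} \<or> B = {}")
      case False
      then obtain x y where xy: "x \<in> A" "y \<in> B" by blast
      then have "A = {x}" "B = {x}" using eq by (auto dest: eq[OF xy(1)] eq[OF _ xy(2)])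
      then show ?thesis by blast
    qed blast
  qed auto
qed

section \<open>Counting the neighbours\<close>

theorem theorem4p2:
  fixes G :: "'a::finite graph" and M :: "'a set set" and m :: nat
  assumes "finite_simple_graph G"
    and "card (edges G) = m"
    and "matching G M"
    and "M \<noteq> {}"
  shows "matching_degree G M = m \<longleftrightarrow> (\<forall>e \<in> M. bond G e \<or> pendant_edge G e)"
proof -
  let ?A = "{N. matching G N \<and> adjacent_matchings M N}"
  let ?T = "toggle_edge M ` edges G"
  have sub: "?T \<subseteq> ?A"
    by (simp add: image_subset_iff matching_toggle_edge[OF \<open>matching G M\<close>] adjacent_toggle_edge)
  have m: "card ?T = m"
    unfolding assms(2)[symmetric]
    by (rule card_image) (rule inj_on_subset[OF inj_toggle_edge subset_UNIV])
  \<comment> \<open>The toggles are \<open>m\<close> distinct neighbours, so in a finite set the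
    degree is \<open>m\<close> exactly when there are no others.\<close>
  have "matching_degree G M = m \<longleftrightarrow> ?T = ?A"
    unfolding matching_degree_eq_card[OF \<open>matching G M\<close>] m[symmetric]
  proof
    assume "card ?A = card ?T"
    then show "?T = ?A" by (intro card_subset_eq[OF _ sub]) simp_all
  qed simp
  also have "\<dots> \<longleftrightarrow> (\<forall>e\<in>M. \<not> (\<exists>f\<in>edges G. \<exists>g\<in>edges G.
      disjnt f g \<and> \<not> disjnt e f \<and> \<not> disjnt e g))" (is "_ \<longleftrightarrow> ?R")
  proof
    assume eq: "?T = ?A"
    have False if e: "e \<in> M" and fg: "f \<in> edges G" "g \<in> edges G" "disjnt f g"
        "\<not> disjnt e f" "\<not> disjnt e g" for e f g
    proof -
      obtain N where "matching G N" "adjacent_matchings M N" and N: "N \<notin> range (toggle_edge M)"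
        using adjacent_matching_not_toggle[OF \<open>matching G M\<close> e fg] .
      then have "N \<in> ?T" unfolding eq by simp
      with N show False by blast
    qed
    then show ?R by blast
  next
    assume R: ?R
    have "N \<in> ?T" if "N \<in> ?A" for N
    proof (rule adjacent_matching_is_toggle[OF \<open>matching G M\<close>])
      show "matching G N" "adjacent_matchings M N" using that by simp_all
      fix e f g
      assume "e \<in> M" "f \<in> edges G" "g \<in> edges G" "disjnt f g" "\<not> disjnt e f" "\<not> disjnt e g"
      with R show False by blast
    qed
    with sub show "?T = ?A" by (intro equalityI subsetI) (rule subsetD)
  qed
  also have "\<dots> \<longleftrightarrow> (\<forall>e \<in> M. bond G e \<or> pendant_edge G e)"
  proof (rule ball_cong[OF refl])
    fix e assume "e \<in> M"
    then have "e \<in> edges G" using \<open>matching G M\<close> by (auto simp: matching_def)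
    from bond_or_pendant_edge_iff[OF \<open>finite_simple_graph G\<close> this, symmetric]
    show "(\<not> (\<exists>f\<in>edges G. \<exists>g\<in>edges G. disjnt f g \<and> \<not> disjnt e f \<and> \<not> disjnt e g))
        \<longleftrightarrow> bond G e \<or> pendant_edge G e" .
  qed
  finally show ?thesis .
qed

end
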